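(* Let $H$ be a finite simple $\Delta(H)$-regular graph with $\operatorname{diam}(L(H))\le 3$. For every prime power $q$, the following properties hold for the graph $G[H,q]$: (i) The graph $G[H,q]$ is regular with $\Delta(G[H,q])=\Delta(H)(q+1)$. (ii) $|E(G[H,q])|=|E(H)|(q+1)(q^2+q+1)$. (iii) $\operatorname{diam}(L(G[H,q]))\le 3$.
   Context: All graphs are finite and simple. $\Delta(G)$ is the maximum degree of $G$, $L(G)$ is the line graph of $G$, and $\operatorname{diam}(F)\le 3$ means that any two vertices of $F$ are at distance at most $3$ in $F$. For a prime power $q$, $\mathrm{PG}(2,q)$ denotes the set of all $1$-dimensional subspaces $\langle x\rangle$ of $\mathbb{F}_q^3$ (the projective points), generated by nonzero vectors $x$. Let $\langle x,y\rangle:=x_1y_1+x_2y_2+x_3y_3$ be the standard bilinear form on $\mathbb{F}_q^3$. For a projective point $\alpha=\langle x\rangle$, put $\alpha^\perp:=\{\langle y\rangle\in\mathrm{PG}(2,q):\langle x,y\rangle=0\}$. For a simple graph $H$, the simple graph $G[H,q]$ has vertex set $V(H)\times\mathrm{PG}(2,q)$, and two vertices $(u,\alpha)$ and $(v,\beta)$ are adjacent in $G[H,q]$ if and only if $uv\in E(H)$ and $\beta\in\alpha^\perp$. *)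

theory Defs
  imports
    "HOL-Analysis.Cartesian_Space"
    "HOL-Library.Extended_Nat"
    "HOL-Number_Theory.Prime_Powers"
begin

section \<open>Finite simple graphs\<close>

record 'a sgraph =
  verts :: "'a set"
  edges :: "'a set set"

definition simple_graph :: "'a sgraph \<Rightarrow> bool" where
  "simple_graph G \<longleftrightarrow>
     finite (verts G) \<and> (\<forall>e\<in>edges G. e \<subseteq> verts G \<and> card e = 2)"

definition degree :: "'a sgraph \<Rightarrow> 'a \<Rightarrow> nat" where
  "degree G v = card {w \<in> verts G. {v, w} \<in> edges G}"

text \<open>Inserting \<open>0\<close> only matters for the graph without vertices, which gets maximum degree \<open>0\<close>.\<close>

definition max_degree :: "'a sgraph \<Rightarrow> nat" where
  "max_degree G = Max (insert 0 (degree G ` verts G))"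

definition regular :: "nat \<Rightarrow> 'a sgraph \<Rightarrow> bool" where
  "regular d G \<longleftrightarrow> (\<forall>v\<in>verts G. degree G v = d)"

definition line_graph :: "'a sgraph \<Rightarrow> 'a set sgraph" where
  "line_graph G =
     \<lparr>verts = edges G,
      edges = {{e, f} |e f. e \<in> edges G \<and> f \<in> edges G \<and> e \<noteq> f \<and> e \<inter> f \<noteq> {}}\<rparr>"

definition is_walk :: "'a sgraph \<Rightarrow> 'a \<Rightarrow> 'a list \<Rightarrow> 'a \<Rightarrow> bool" where
  "is_walk G u p v \<longleftrightarrow>
     p \<noteq> [] \<and> hd p = u \<and> last p = v \<and> set p \<subseteq> verts G \<and>
     successively (\<lambda>x y. {x, y} \<in> edges G) p"

text \<open>A walk is given by its list of vertices, so its length is one less than that of the list.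
  Vertices not joined by any walk are at distance \<open>\<infinity>\<close>, the infimum of the empty set.\<close>

definition graph_dist :: "'a sgraph \<Rightarrow> 'a \<Rightarrow> 'a \<Rightarrow> enat" where
  "graph_dist G u v = (INF p\<in>{p. is_walk G u p v}. enat (length p - 1))"

definition diam :: "'a sgraph \<Rightarrow> enat" where
  "diam G = (SUP u\<in>verts G. SUP v\<in>verts G. graph_dist G u v)"

lemma diam_le_iff:
  "diam G \<le> k \<longleftrightarrow> (\<forall>u\<in>verts G. \<forall>v\<in>verts G. graph_dist G u v \<le> k)"
  by (simp add: diam_def SUP_le_iff)


section \<open>The projective plane and its orthogonal polarity\<close>

text \<open>The field with \<open>q\<close> elements is any type \<open>'f\<close> of class \<^class>\<open>field\<close> with \<open>CARD('f) = q\<close>.\<close>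

definition PG2 :: "('f::field ^ 3) set set" where
  "PG2 = {S. vec.subspace S \<and> vec.dim S = 1}"

definition bilin :: "'f::field ^ 3 \<Rightarrow> 'f ^ 3 \<Rightarrow> 'f" where
  "bilin x y = x $ 1 * y $ 1 + x $ 2 * y $ 2 + x $ 3 * y $ 3"

text \<open>Whether \<^term>\<open>bilin x y = 0\<close> does not depend on the chosen generators \<open>x\<close>, \<open>y\<close>.\<close>

definition perp :: "('f::field ^ 3) set \<Rightarrow> ('f ^ 3) set set" where
  "perp \<alpha> = {\<beta> \<in> PG2. \<exists>x y. x \<noteq> 0 \<and> y \<noteq> 0 \<and>
     \<alpha> = vec.span {x} \<and> \<beta> = vec.span {y} \<and> bilin x y = 0}"


section \<open>The graph \<open>G[H,q]\<close>\<close>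

text \<open>The type argument selects the field \<open>'f\<close> with \<open>q\<close> elements.\<close>

definition polarity_product ::
    "'v sgraph \<Rightarrow> 'f::field itself \<Rightarrow> ('v \<times> ('f ^ 3) set) sgraph" where
  "polarity_product H F =
     \<lparr>verts = verts H \<times> PG2,
      edges = {{(u, \<alpha>), (v, \<beta>)} |u v \<alpha> \<beta>.
                 {u, v} \<in> edges H \<and> \<alpha> \<in> PG2 \<and> \<beta> \<in> perp \<alpha>}\<rparr>"

lemma PG2_eq: "PG2 = {vec.span {x} |x :: 'f::field ^ 3. x \<noteq> 0}"
proof (intro equalityI subsetI)
  fix S :: "('f ^ 3) set" assume "S \<in> PG2"
  hence S: "vec.subspace S" "vec.dim S = 1" by (auto simp: PG2_def)
  obtain B where B: "B \<subseteq> S" "vec.independent B" "S \<subseteq> vec.span B" "card B = vec.dim S"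
    using vec.basis_exists by blast
  then obtain x where x: "B = {x}" using S by (metis card_1_singletonE)
  have "x \<noteq> 0" using B(2) x by auto
  moreover have "S = vec.span {x}"
    using B S x vec.span_minimal[of B S] by blast
  ultimately show "S \<in> {vec.span {x} |x. x \<noteq> 0}" by blast
next
  fix S :: "('f ^ 3) set" assume "S \<in> {vec.span {x} |x. x \<noteq> 0}"
  then obtain x where x: "x \<noteq> 0" "S = vec.span {x}" by blast
  have "vec.independent {x}" using x(1) by simp
  hence "vec.dim {x} = 1" using vec.dim_eq_card_independent by fastforce
  thus "S \<in> PG2" using x(2) by (simp add: PG2_def)
qed

lemma bilin_commute: "bilin x y = bilin y x"
  by (simp add: bilin_def mult.commute)

lemma perp_sym:
  assumes "\<alpha> \<in> PG2" "\<beta> \<in> perp \<alpha>"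
  shows "\<alpha> \<in> perp \<beta>"
proof -
  from assms(2) obtain x y where xy: "x \<noteq> 0" "y \<noteq> 0" "\<alpha> = vec.span {x}"
    "\<beta> = vec.span {y}" "bilin x y = 0"
    unfolding perp_def by blast
  have "bilin y x = 0"
    using xy(5) by (subst bilin_commute)
  with assms(1) xy(1-4) show ?thesis unfolding perp_def by blast
qed

lemma adjacent_polarity_product:
  assumes "\<alpha> \<in> PG2"
  shows "{(u, \<alpha>), (v, \<beta>)} \<in> edges (polarity_product H F) \<longleftrightarrow>
         {u, v} \<in> edges H \<and> \<beta> \<in> perp \<alpha>"
proof
  assume "{(u, \<alpha>), (v, \<beta>)} \<in> edges (polarity_product H F)"
  thus "{u, v} \<in> edges H \<and> \<beta> \<in> perp \<alpha>"
    using perp_sym by (auto simp: polarity_product_def doubleton_eq_iff insert_commute)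
next
  assume "{u, v} \<in> edges H \<and> \<beta> \<in> perp \<alpha>"
  thus "{(u, \<alpha>), (v, \<beta>)} \<in> edges (polarity_product H F)"
    using assms by (auto simp: polarity_product_def)
qed

lemma simple_graph_polarity_product:
  fixes F :: "'f::{field,finite} itself"
  assumes "simple_graph H"
  shows "simple_graph (polarity_product H F)"
  unfolding simple_graph_def
proof (intro conjI ballI)
  have "finite (PG2 :: ('f ^ 3) set set)"
    by (rule finite_subset[OF subset_UNIV]) simp
  thus "finite (verts (polarity_product H F))"
    using assms by (simp add: simple_graph_def polarity_product_def)
next
  fix e assume "e \<in> edges (polarity_product H F)"
  then obtain u v \<alpha> \<beta> where e: "e = {(u, \<alpha>), (v, \<beta>)}"
    and uv: "{u, v} \<in> edges H" and "\<alpha> \<in> PG2" "\<beta> \<in> PG2"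
    by (auto simp: perp_def polarity_product_def)
  moreover from uv assms have "u \<noteq> v" "u \<in> verts H" "v \<in> verts H"
    unfolding simple_graph_def by fastforce+
  ultimately show "e \<subseteq> verts (polarity_product H F)" "card e = 2"
    by (simp_all add: polarity_product_def)
qed

end

theory Submission
  imports Defs
begin

text \<open>
  Write \<open>G\<close> for \<open>G[H,q]\<close>. The counts in (i) and (ii) reduce to two numbers, the size \<open>q\<^sup>2 + q + 1\<close>
  of the plane and the size \<open>q + 1\<close> of a polar line: the neighbourhood of \<open>(u, \<alpha>)\<close> is the product of
  the neighbourhood of \<open>u\<close> with \<open>\<alpha>\<^sup>\<bottom>\<close>, which gives the degrees, and double counting of incident
  pairs then turns degrees into the number of edges. Both sizes come from one principle: the
  points inside a subspace partition its nonzero vectors into classes of size \<open>q - 1\<close>.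

  For (iii), two edges of a simple graph are at distance at most \<open>3\<close> in its line graph if and only
  if some end of one is joined to some end of the other by a walk of length \<^emph>\<open>exactly\<close> two
  (\<open>line_graph_dist_le_3_iff\<close>); shorter connections can be prolonged to length two because an edge
  offers its other end. Such a walk \<open>x, w, y\<close> in \<open>H\<close> lifts to \<open>G\<close> with arbitrary prescribed points
  \<open>\<xi>\<close> above \<open>x\<close> and \<open>\<eta>\<close> above \<open>y\<close>, since the lines \<open>\<xi>\<^sup>\<bottom>\<close> and \<open>\<eta>\<^sup>\<bottom>\<close> always meet and any common
  point can be placed above \<open>w\<close>. Hence the condition passes from \<open>H\<close> to \<open>G\<close>.
\<close>

section \<open>Distance in line graphs\<close>

lemma graph_dist_le_iff:
  "graph_dist G u v \<le> enat k \<longleftrightarrow> (\<exists>p. is_walk G u p v \<and> length p \<le> Suc k)"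
proof -
  have "graph_dist G u v \<le> enat k \<longleftrightarrow> graph_dist G u v < enat (Suc k)"
    by (cases "graph_dist G u v") (simp_all add: less_Suc_eq_le)
  also have "\<dots> \<longleftrightarrow> (\<exists>p. is_walk G u p v \<and> length p \<le> Suc k)"
    unfolding graph_dist_def INF_less_iff by auto
  finally show ?thesis .
qed

lemma simple_graph_edgeE:
  assumes "simple_graph G" "e \<in> edges G" "x \<in> e"
  obtains a where "e = {x, a}" "a \<noteq> x"
proof -
  from assms have "card e = 2" by (auto simp: simple_graph_def)
  then obtain a b where "e = {a, b}" "a \<noteq> b" by (auto simp: card_2_iff)
  with assms(3) that show ?thesis by (metis insert_commute insertE singletonD)
qed

lemma simple_graph_edge_eq:
  assumes "simple_graph G" "e \<in> edges G" "x \<in> e" "y \<in> e" "x \<noteq> y"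
  shows "e = {x, y}"
  using simple_graph_edgeE[OF assms(1-3)] assms(4,5) by blast

lemma verts_line_graph: "verts (line_graph G) = edges G"
  by (simp add: line_graph_def)

lemma line_graph_adjacent_iff:
  "{e, f} \<in> edges (line_graph G) \<longleftrightarrow>
     e \<in> edges G \<and> f \<in> edges G \<and> e \<noteq> f \<and> e \<inter> f \<noteq> {}"
  by (auto simp: line_graph_def doubleton_eq_iff)

text \<open>
  Replacing adjacency in the line graph by the reflexive relation of having a common vertex makes
  it possible to speak of sequences of length exactly three: short walks are padded by repeating
  the last edge, and conversely repetitions are removed.
\<close>

lemma line_graph_dist_le_3_iff_meet:
  assumes "simple_graph G" "e \<in> edges G" "f \<in> edges G"
  shows "graph_dist (line_graph G) e f \<le> 3 \<longleftrightarrow>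
    (\<exists>e1\<in>edges G. \<exists>e2\<in>edges G. e \<inter> e1 \<noteq> {} \<and> e1 \<inter> e2 \<noteq> {} \<and> e2 \<inter> f \<noteq> {})"
    (is "?L \<longleftrightarrow> ?R")
proof
  have ne: "c \<noteq> {}" if "c \<in> edges G" for c
    using that assms(1) by (auto simp: simple_graph_def)
  {
    assume ?L
    then obtain p where p: "is_walk (line_graph G) e p f" "length p \<le> 4"
      using graph_dist_le_iff[of "line_graph G" e f 3] by (auto simp: numeral_eq_enat)
    have "p \<noteq> []" and ends: "hd p = e" "last p = f" using p(1) by (simp_all add: is_walk_def)
    then obtain p' where p': "p = e # p'" by (cases p) auto
    consider "p' = []" | a where "p' = [a]" | a b where "p' = [a, b]"
      | a b c where "p' = [a, b, c]"
      | a b c d r where "p' = a # b # c # d # r"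
      by (metis list.exhaust)
    then show ?R
    proof cases
      case 1
      then have "e = f" using ends p' by simp
      then show ?thesis using ne assms(2) by blast
    next
      case 2
      then have "e \<inter> f \<noteq> {}"
        using p(1) ends p' by (auto simp: is_walk_def line_graph_adjacent_iff)
      then show ?thesis using ne assms(2,3) by blast
    next
      case (3 a b)
      then have "a \<in> edges G" "e \<inter> a \<noteq> {}" "a \<inter> f \<noteq> {}"
        using p(1) ends p' by (auto simp: is_walk_def line_graph_adjacent_iff)
      then show ?thesis using ne assms(3) by blast
    next
      case (4 a b c)
      then have "a \<in> edges G" "b \<in> edges G" "e \<inter> a \<noteq> {}" "a \<inter> b \<noteq> {}" "b \<inter> f \<noteq> {}"
        using p(1) ends p' by (auto simp: is_walk_def line_graph_adjacent_iff)
      then show ?thesis by blast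
    next
      case 5
      then show ?thesis using p(2) p' by simp
    qed
  }
  {
    assume ?R
    then obtain c d where cd: "c \<in> edges G" "d \<in> edges G"
      "e \<inter> c \<noteq> {}" "c \<inter> d \<noteq> {}" "d \<inter> f \<noteq> {}" by blast
    let ?p = "remdups_adj [e, c, d, f]"
    have "is_walk (line_graph G) e ?p f"
      using cd assms(2,3)
      by (auto simp: is_walk_def line_graph_adjacent_iff verts_line_graph)
    moreover have "length ?p \<le> 4"
      by simp
    ultimately show ?L
      using graph_dist_le_iff[of "line_graph G" e f 3] by (auto simp: numeral_eq_enat)
  }
qed

text \<open>
  Three steps from \<open>e\<close> to \<open>f\<close> pass two intermediate edges, and these form the walk \<open>x, w, y\<close>.
  Asking for length exactly two loses nothing, as the ends of \<open>e\<close> and \<open>f\<close> may be chosen freely,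
  and makes the criterion uniform: coinciding and adjacent edges need no separate treatment.
\<close>

lemma line_graph_dist_le_3_iff:
  assumes G: "simple_graph G" and ef: "e \<in> edges G" "f \<in> edges G"
  shows "graph_dist (line_graph G) e f \<le> 3 \<longleftrightarrow>
    (\<exists>x\<in>e. \<exists>y\<in>f. \<exists>w. {x, w} \<in> edges G \<and> {w, y} \<in> edges G)"
    (is "?L \<longleftrightarrow> ?R")
proof
  assume ?L
  then obtain c d x w y where cd: "c \<in> edges G" "d \<in> edges G"
    and x: "x \<in> e" "x \<in> c" and w: "w \<in> c" "w \<in> d" and y: "y \<in> d" "y \<in> f"
    unfolding line_graph_dist_le_3_iff_meet[OF assms] by blast
  obtain a where a: "e = {x, a}" using simple_graph_edgeE[OF G ef(1) x(1)] .
  obtain b where b: "f = {y, b}" using simple_graph_edgeE[OF G ef(2) y(2)] .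
  have c: "{x, w} \<in> edges G" if "x \<noteq> w"
    using simple_graph_edge_eq[OF G cd(1) x(2) w(1) that] cd(1) by simp
  have d: "{w, y} \<in> edges G" if "w \<noteq> y"
    using simple_graph_edge_eq[OF G cd(2) w(2) y(1) that] cd(2) by simp
  \<comment> \<open>When the walk \<open>x, w, y\<close> degenerates, step back into \<open>e\<close> or on into \<open>f\<close> instead.\<close>
  consider "x \<noteq> w" "w \<noteq> y" | "x = w" "w \<noteq> y" | "x \<noteq> w" "w = y" | "x = w" "w = y" by blast
  then show ?R
  proof cases
    case 1 then show ?thesis using c d x(1) y(2) by blast
  next
    case 2
    have "{a, x} \<in> edges G" "{x, y} \<in> edges G"
      using a ef(1) d 2 by (simp_all add: insert_commute)
    then show ?thesis using a y(2) by blast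
  next
    case 3
    have "{x, y} \<in> edges G" "{y, b} \<in> edges G"
      using b ef(2) c 3 by simp_all
    then show ?thesis using b x(1) by blast
  next
    case 4
    have "{x, a} \<in> edges G" "{a, y} \<in> edges G"
      using a ef(1) 4 by (simp_all add: insert_commute)
    then show ?thesis using x(1) y(2) by blast
  qed
next
  assume ?R
  then obtain x y w where xy: "x \<in> e" "y \<in> f" and xwy: "{x, w} \<in> edges G" "{w, y} \<in> edges G"
    by blast
  have "e \<inter> {x, w} \<noteq> {}" "{x, w} \<inter> {w, y} \<noteq> {}" "{w, y} \<inter> f \<noteq> {}"
    using xy by auto
  with xwy show ?L
    unfolding line_graph_dist_le_3_iff_meet[OF assms] by (intro bexI conjI)
qed


section \<open>Degrees and the number of edges\<close>

lemma handshake: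
  assumes G: "simple_graph G"
  shows "(\<Sum>v\<in>verts G. degree G v) = 2 * card (edges G)"
proof -
  have fin: "finite (verts G)" using G by (simp add: simple_graph_def)
  have "edges G \<subseteq> Pow (verts G)" using G by (auto simp: simple_graph_def)
  then have finE: "finite (edges G)" using fin finite_subset by blast
  have deg: "degree G v = card {e \<in> edges G. v \<in> e}" for v
  proof -
    have "bij_betw (\<lambda>w. {v, w}) {w \<in> verts G. {v, w} \<in> edges G} {e \<in> edges G. v \<in> e}"
    proof (rule bij_betw_imageI)
      show "inj_on (\<lambda>w. {v, w}) {w \<in> verts G. {v, w} \<in> edges G}"
        by (auto simp: inj_on_def doubleton_eq_iff)
      show "(\<lambda>w. {v, w}) ` {w \<in> verts G. {v, w} \<in> edges G} = {e \<in> edges G. v \<in> e}"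
      proof (intro equalityI subsetI)
        fix e assume "e \<in> {e \<in> edges G. v \<in> e}"
        then have e: "e \<in> edges G" "v \<in> e" by auto
        obtain a where "e = {v, a}" using simple_graph_edgeE[OF G e] .
        moreover have "e \<subseteq> verts G" using G e by (auto simp: simple_graph_def)
        ultimately show "e \<in> (\<lambda>w. {v, w}) ` {w \<in> verts G. {v, w} \<in> edges G}"
          using e by auto
      qed auto
    qed
    then show ?thesis unfolding degree_def by (rule bij_betw_same_card)
  qed
  have "{v \<in> verts G. v \<in> e} = e" if "e \<in> edges G" for e
    using that G by (auto simp: simple_graph_def)
  then have "\<forall>e\<in>edges G. card {v \<in> verts G. v \<in> e} = 2"
    using G by (simp add: simple_graph_def)
  from sum_multicount_gen[OF fin finE this]
  show ?thesis by (simp add: deg)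
qed

lemma handshake_regular:
  assumes "simple_graph G" "regular d G"
  shows "card (verts G) * d = 2 * card (edges G)"
  using handshake[OF assms(1)] assms(2) by (simp add: regular_def)

lemma max_degree_regular:
  assumes "regular d G" "verts G \<noteq> {}"
  shows "max_degree G = d"
proof -
  have "degree G ` verts G = {d}" using assms by (auto simp: regular_def)
  then show ?thesis by (simp add: max_degree_def)
qed


section \<open>Counting points of the projective plane\<close>

lemma bilin_add_right: "bilin x (y + z) = bilin x y + bilin x z"
  by (simp add: bilin_def algebra_simps)

lemma bilin_scale_right: "bilin x (c *s y) = c * bilin x y"
  by (simp add: bilin_def algebra_simps)

lemma bilin_scale_left: "bilin (c *s x) y = c * bilin x y"
  by (simp add: bilin_def algebra_simps)

lemma bilin_diff_right: "bilin x (y - z) = bilin x y - bilin x z"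
  by (simp add: bilin_def algebra_simps)

lemma subspace_bilin: "vec.subspace {y. bilin x y = 0}"
  by (rule vec.subspaceI)
     (simp_all add: bilin_add_right bilin_scale_right, simp add: bilin_def)

lemma PG2_eq_span:
  assumes "S \<in> PG2" "x \<in> S" "x \<noteq> 0"
  shows "S = vec.span {x}"
proof -
  obtain y where S: "S = vec.span {y}" using assms(1) by (auto simp: PG2_eq)
  then obtain c where c: "x = c *s y" using assms(2) by (auto simp: vec.span_singleton)
  then have "c \<noteq> 0" using assms(3) by auto
  then have "y = inverse c *s x" by (simp add: c)
  then have "y \<in> vec.span {x}" by (auto simp: vec.span_singleton)
  then have "S \<subseteq> vec.span {x}"
    unfolding S by (intro vec.span_minimal vec.subspace_span) simp
  moreover have "vec.span {x} \<subseteq> S"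
    using assms(2) unfolding S by (intro vec.span_minimal vec.subspace_span) simp
  ultimately show ?thesis by blast
qed

lemma perp_eq:
  assumes "x \<noteq> 0"
  shows "perp (vec.span {x}) = {S \<in> PG2. S \<subseteq> {y. bilin x y = 0}}"
proof (intro equalityI subsetI)
  fix S assume "S \<in> perp (vec.span {x})"
  then obtain x' y where S: "S \<in> PG2" "S = vec.span {y}" and x': "vec.span {x} = vec.span {x'}"
    and o: "bilin x' y = 0" unfolding perp_def by blast
  have "x \<in> vec.span {x'}" using x' vec.span_base by blast
  then obtain c where "x = c *s x'" by (auto simp: vec.span_singleton)
  then show "S \<in> {S \<in> PG2. S \<subseteq> {y. bilin x y = 0}}"
    using S o by (auto simp: vec.span_singleton bilin_scale_left bilin_scale_right)
next
  fix S assume "S \<in> {S \<in> PG2. S \<subseteq> {y. bilin x y = 0}}"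
  then have S: "S \<in> PG2" "S \<subseteq> {y. bilin x y = 0}" by auto
  then obtain y where "S = vec.span {y}" "y \<noteq> 0" by (auto simp: PG2_eq)
  moreover from this have "bilin x y = 0" using S(2) vec.span_base by blast
  ultimately show "S \<in> perp (vec.span {x})"
    using S(1) assms unfolding perp_def by blast
qed

lemma perp_subset_PG2: "perp \<alpha> \<subseteq> PG2"
  by (auto simp: perp_def)

lemma card_field_ge_2: "2 \<le> CARD('f::{field,finite})"
proof -
  have "card {0, 1::'f} \<le> CARD('f)" by (rule card_mono) auto
  then show ?thesis by simp
qed

text \<open>
  Every nonzero vector of \<open>W\<close> lies in exactly one point, and that point lies inside \<open>W\<close>.
\<close>

lemma card_points_in_subspace:
  fixes W :: "('f::{field,finite} ^ 3) set"
  assumes W: "vec.subspace W"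
  shows "card {S \<in> PG2. S \<subseteq> W} * (CARD('f) - 1) + 1 = card W"
proof -
  let ?P = "{S \<in> PG2. S \<subseteq> W}"
  have fin: "finite A" for A :: "('f ^ 3) set" by (rule finite_subset[OF subset_UNIV]) simp
  have finP: "finite ?P" by (rule finite_subset[OF subset_UNIV]) simp
  have card1: "card (S - {0}) = CARD('f) - 1" if S: "S \<in> PG2" for S :: "('f ^ 3) set"
  proof -
    obtain x where x: "x \<noteq> 0" "S = vec.span {x}" using S by (auto simp: PG2_eq)
    have "inj (\<lambda>c. c *s x)"
      using x(1) by (auto simp: inj_on_def vec.scale_right_imp_eq)
    then have "card S = CARD('f)" by (simp add: x(2) vec.span_singleton card_image)
    moreover have "0 \<in> S" by (simp add: x(2) vec.span_zero)
    ultimately show ?thesis by (simp add: fin)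
  qed
  have "W - {0} = (\<Union>S\<in>?P. S - {0})"
  proof (intro equalityI subsetI)
    fix x assume x: "x \<in> W - {0}"
    then have "vec.span {x} \<subseteq> W" using W by (simp add: vec.span_minimal)
    moreover have "vec.span {x} \<in> PG2" using x by (auto simp: PG2_eq)
    moreover have "x \<in> vec.span {x}" by (simp add: vec.span_base)
    ultimately show "x \<in> (\<Union>S\<in>?P. S - {0})" using x by blast
  qed auto
  also have "card \<dots> = (\<Sum>S\<in>?P. card (S - {0}))"
  proof (rule card_UN_disjoint[OF finP])
    show "\<forall>S\<in>?P. finite (S - {0})" using fin by blast
    show "\<forall>S\<in>?P. \<forall>T\<in>?P. S \<noteq> T \<longrightarrow> (S - {0}) \<inter> (T - {0}) = {}"
      using PG2_eq_span by blast
  qed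
  also have "\<dots> = card ?P * (CARD('f) - 1)" using card1 by simp
  finally have "card (W - {0}) = card ?P * (CARD('f) - 1)" .
  moreover have "Suc (card (W - {0})) = card W"
    using fin W by (intro card_Suc_Diff1) (simp_all add: vec.subspace_0)
  ultimately show ?thesis by linarith
qed

lemma card_PG2:
  "card (PG2 :: ('f::{field,finite} ^ 3) set set) = CARD('f)\<^sup>2 + CARD('f) + 1"
proof -
  \<comment> \<open>Writing \<open>q = k + 2\<close> allows division by \<open>q - 1 = k + 1\<close> without truncated subtraction.\<close>
  obtain k where k: "CARD('f) = Suc (Suc k)"
    using card_field_ge_2[where 'f='f] by (metis add_2_eq_Suc le_Suc_ex)
  have "card (PG2 :: ('f ^ 3) set set) * Suc k + 1 = CARD('f) ^ 3"
    using card_points_in_subspace[of "UNIV :: ('f ^ 3) set"] k by simp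
  also have "\<dots> = (CARD('f)\<^sup>2 + CARD('f) + 1) * Suc k + 1"
    by (simp add: k power2_eq_square power3_eq_cube algebra_simps)
  finally show ?thesis by (metis add_right_cancel mult_cancel2 nat.distinct(1))
qed

text \<open>
  With \<open>z\<close> chosen such that \<open>bilin x z = 1\<close>, every vector is uniquely \<open>w + c z\<close> with \<open>w\<close>
  orthogonal to \<open>x\<close>.
\<close>

lemma card_orthogonal:
  fixes x :: "'f::{field,finite} ^ 3"
  assumes "x \<noteq> 0"
  shows "card {y. bilin x y = 0} = CARD('f)\<^sup>2"
proof -
  have "\<exists>z. bilin x z = 1"
  proof -
    have "x $ 1 \<noteq> 0 \<or> x $ 2 \<noteq> 0 \<or> x $ 3 \<noteq> 0"
      using assms by (auto simp: vec_eq_iff forall_3)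
    then show ?thesis
      using exI[of "\<lambda>z. bilin x z = 1" "axis 1 (inverse (x $ 1))"]
        exI[of "\<lambda>z. bilin x z = 1" "axis 2 (inverse (x $ 2))"]
        exI[of "\<lambda>z. bilin x z = 1" "axis 3 (inverse (x $ 3))"]
      by (auto simp: bilin_def axis_def)
  qed
  then obtain z where z: "bilin x z = 1" ..
  have "bij_betw (\<lambda>(w, c). w + c *s z) ({y. bilin x y = 0} \<times> UNIV) UNIV"
  proof (rule bij_betw_byWitness[where f' = "\<lambda>v. (v - bilin x v *s z, bilin x v)"])
  qed (auto simp: bilin_add_right bilin_diff_right bilin_scale_right z)
  then have "card ({y. bilin x y = 0} \<times> (UNIV :: 'f set)) = CARD('f ^ 3)"
    by (rule bij_betw_same_card)
  then have "card {y. bilin x y = 0} * CARD('f) = CARD('f)\<^sup>2 * CARD('f)"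
    by (simp add: card_cartesian_product power2_eq_square power3_eq_cube)
  then show ?thesis by simp
qed

lemma card_perp:
  fixes \<alpha> :: "('f::{field,finite} ^ 3) set"
  assumes "\<alpha> \<in> PG2"
  shows "card (perp \<alpha>) = CARD('f) + 1"
proof -
  obtain x where x: "x \<noteq> 0" "\<alpha> = vec.span {x}" using assms by (auto simp: PG2_eq)
  \<comment> \<open>Writing \<open>q = k + 2\<close> allows division by \<open>q - 1 = k + 1\<close> without truncated subtraction.\<close>
  obtain k where k: "CARD('f) = Suc (Suc k)"
    using card_field_ge_2[where 'f='f] by (metis add_2_eq_Suc le_Suc_ex)
  have "card (perp \<alpha>) * Suc k + 1 = CARD('f)\<^sup>2"
    using card_points_in_subspace[OF subspace_bilin[of x]] card_orthogonal[OF x(1)] k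
    by (simp add: x(2) perp_eq[OF x(1)])
  also have "\<dots> = (CARD('f) + 1) * Suc k + 1"
    by (simp add: k power2_eq_square algebra_simps)
  finally show ?thesis by (metis add_right_cancel mult_cancel2 nat.distinct(1))
qed

text \<open>
  Two linear conditions on three coordinates have a nonzero solution; over a finite field this is
  the pigeonhole principle, as there are only \<open>q\<^sup>2\<close> pairs of values for \<open>q\<^sup>3\<close> vectors.
\<close>

lemma perp_Int_nonempty:
  fixes \<alpha> \<beta> :: "('f::{field,finite} ^ 3) set"
  assumes "\<alpha> \<in> PG2" "\<beta> \<in> PG2"
  shows "perp \<alpha> \<inter> perp \<beta> \<noteq> {}"
proof -
  obtain x y where x: "x \<noteq> 0" "\<alpha> = vec.span {x}" and y: "y \<noteq> 0" "\<beta> = vec.span {y}"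
    using assms by (auto simp: PG2_eq)
  let ?h = "\<lambda>z. (bilin x z, bilin y z)"
  have "CARD('f \<times> 'f) < CARD('f ^ 3)"
    using card_field_ge_2[where 'f='f] by (simp add: power3_eq_cube)
  then have "\<not> inj ?h"
    using card_inj_on_le[of ?h UNIV UNIV] by auto
  then obtain z z' where zz: "z \<noteq> z'" "?h z = ?h z'" by (auto simp: inj_on_def)
  then have "z - z' \<noteq> 0" "bilin x (z - z') = 0" "bilin y (z - z') = 0"
    by (simp_all add: bilin_diff_right)
  then have "vec.span {z - z'} \<in> perp \<alpha> \<inter> perp \<beta>"
    using x y unfolding perp_def PG2_eq by blast
  then show ?thesis by blast
qed


section \<open>The polarity product\<close>

lemma verts_polarity_product: "verts (polarity_product H F) = verts H \<times> PG2"
  by (simp add: polarity_product_def)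

lemma degree_polarity_product:
  assumes "\<alpha> \<in> (PG2 :: ('f::{field,finite} ^ 3) set set)"
  shows "degree (polarity_product H TYPE('f)) (u, \<alpha>) = degree H u * (CARD('f) + 1)"
proof -
  have "{w \<in> verts (polarity_product H TYPE('f)). {(u, \<alpha>), w} \<in> edges (polarity_product H TYPE('f))}
      = {v \<in> verts H. {u, v} \<in> edges H} \<times> perp \<alpha>"
    using perp_subset_PG2[of \<alpha>]
    by (auto simp: adjacent_polarity_product[OF assms] verts_polarity_product)
  then show ?thesis
    using card_perp[OF assms] by (simp add: degree_def card_cartesian_product)
qed

text \<open>
  The middle vertex of a walk of length two is the only one whose point can be chosen, and it is
  subject to just two polarity conditions; this is why walks of length two lift.
\<close>

lemma line_graph_dist_polarity_product:
  fixes F :: "'f::{field,finite} itself"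
  assumes H: "simple_graph H"
    and dist: "\<And>e f. e \<in> edges H \<Longrightarrow> f \<in> edges H \<Longrightarrow> graph_dist (line_graph H) e f \<le> 3"
    and ef: "e \<in> edges (polarity_product H F)" "f \<in> edges (polarity_product H F)"
  shows "graph_dist (line_graph (polarity_product H F)) e f \<le> 3"
proof -
  have edge: "fst ` e \<in> edges H \<and> e \<subseteq> UNIV \<times> PG2" if "e \<in> edges (polarity_product H F)" for e
    using that by (auto simp: polarity_product_def perp_def)
  from dist[of "fst ` e" "fst ` f"] edge ef
  obtain x y w where "x \<in> fst ` e" "y \<in> fst ` f" and xwy: "{x, w} \<in> edges H" "{w, y} \<in> edges H"
    using line_graph_dist_le_3_iff[OF H, of "fst ` e" "fst ` f"] by blast
  then obtain \<xi> \<eta> where \<xi>: "(x, \<xi>) \<in> e" "\<xi> \<in> PG2" and \<eta>: "(y, \<eta>) \<in> f" "\<eta> \<in> PG2"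
    using edge ef by fastforce
  obtain \<gamma> where \<gamma>: "\<gamma> \<in> perp \<xi>" "\<gamma> \<in> perp \<eta>"
    using perp_Int_nonempty[OF \<xi>(2) \<eta>(2)] by blast
  have "{(x, \<xi>), (w, \<gamma>)} \<in> edges (polarity_product H F)"
    using xwy \<gamma> by (simp add: adjacent_polarity_product[OF \<xi>(2)])
  moreover have "{(y, \<eta>), (w, \<gamma>)} \<in> edges (polarity_product H F)"
    using xwy(2) \<gamma> by (simp add: adjacent_polarity_product[OF \<eta>(2)] insert_commute[of y w])
  then have "{(w, \<gamma>), (y, \<eta>)} \<in> edges (polarity_product H F)"
    by (simp add: insert_commute)
  ultimately show ?thesis
    using line_graph_dist_le_3_iff[OF simple_graph_polarity_product[OF H] ef] \<xi>(1) \<eta>(1)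
    by blast
qed

theorem lemma3p3:
  fixes H :: "'v sgraph" and q :: nat
  assumes "simple_graph H"
    and "regular (max_degree H) H"
    and "diam (line_graph H) \<le> 3"
    and "primepow q"
    and "CARD('f::{field,finite}) = q"
  shows "let G = polarity_product H TYPE('f) in
     (regular (max_degree G) G \<and> max_degree G = max_degree H * (q + 1)) \<and>
     card (edges G) = card (edges H) * (q + 1) * (q\<^sup>2 + q + 1) \<and>
     diam (line_graph G) \<le> 3"
proof -
  define G where "G = polarity_product H TYPE('f)"
  let ?d = "max_degree H * (q + 1)"
  have V: "verts G = verts H \<times> PG2" by (simp add: G_def verts_polarity_product)
  have cardP: "card (PG2 :: ('f ^ 3) set set) = q\<^sup>2 + q + 1"
    using card_PG2[where 'f='f] assms(5) by simp
  have G: "simple_graph G"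
    unfolding G_def by (rule simple_graph_polarity_product[OF assms(1)])
  have reg: "regular ?d G"
    using assms(2,5) degree_polarity_product[where 'f='f and H=H]
    by (auto simp: regular_def V) (simp add: G_def)
  \<comment> \<open>Without vertices every \<open>d\<close> makes a graph \<open>d\<close>-regular, so that case is separate.\<close>
  have max: "max_degree G = ?d"
  proof (cases "verts H = {}")
    case True
    then show ?thesis by (simp add: max_degree_def V)
  next
    case False
    moreover have "(PG2 :: ('f ^ 3) set set) \<noteq> {}" using cardP by auto
    ultimately show ?thesis by (intro max_degree_regular[OF reg]) (simp add: V)
  qed
  have "2 * card (edges G) = card (verts G) * ?d"
    using handshake_regular[OF G reg] by simp
  also have "\<dots> = (card (verts H) * max_degree H) * ((q + 1) * (q\<^sup>2 + q + 1))"
    by (simp only: V card_cartesian_product cardP mult_ac)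
  also have "\<dots> = 2 * (card (edges H) * (q + 1) * (q\<^sup>2 + q + 1))"
    unfolding handshake_regular[OF assms(1,2)] by (simp only: mult_ac)
  finally have E: "card (edges G) = card (edges H) * (q + 1) * (q\<^sup>2 + q + 1)"
    unfolding mult_cancel1 by linarith
  have "graph_dist (line_graph H) e f \<le> 3" if "e \<in> edges H" "f \<in> edges H" for e f
    using assms(3) that unfolding diam_le_iff verts_line_graph by blast
  then have "diam (line_graph G) \<le> 3"
    unfolding diam_le_iff verts_line_graph G_def
    by (blast intro: line_graph_dist_polarity_product[OF assms(1)])
  with reg max E show ?thesis unfolding Let_def G_def[symmetric] by simp
qed

end
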